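(* Let $\Gamma$ be a metrized graph with $v \geq 5$ vertices and let $k$ be an integer with $1 \leq k \leq v-4$. Then $$Kf(\Gamma)= \frac{(v-4-k)!}{(v-4)!}\sum_{e_{i_1} \in E(\Gamma)}\frac{R_{i_1}}{L_{i_1}+R_{i_1}} \sum_{e_{i_2} \in E(\overline{\Gamma}_{i_1})}\frac{R_{i_2}}{L_{i_2}+R_{i_2}}\cdots\sum_{e_{i_k} \in E(\overline{\Gamma}_{i_1, \dots, i_{k-1}})}\frac{R_{i_k}}{L_{i_k}+R_{i_k}}\, Kf(\overline{\Gamma}_{i_1,\dots, i_k}) -\frac{\big(v^2-(k+2)v+k-1 \big)k}{(v-k-2)(v-k-3) }\,y(\Gamma),$$ where the sums are over admissible contractions. In particular, for $k=v-4$, $$Kf(\Gamma)= \frac{1}{(v-4)!}\sum_{e_{i_1} \in E(\Gamma)}\frac{R_{i_1}}{L_{i_1}+R_{i_1}} \cdots\sum_{e_{i_{v-4}} \in E(\overline{\Gamma}_{i_1, \dots, i_{v-5}})}\frac{R_{i_{v-4}}}{L_{i_{v-4}}+R_{i_{v-4}}}\, Kf(\overline{\Gamma}_{i_1,\dots, i_{v-4}}) -\frac{(3v-5)(v-4)}{2}\,y(\Gamma).$$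
   Context: A metrized graph $\Gamma$ is a finite connected graph (multiple edges and self-loops allowed) each of whose edges is identified with a closed segment of positive length. Its vertex set $V(\Gamma)$ is a finite nonempty set containing every point of valence $\neq 2$; $v=\#V(\Gamma)$; $E(\Gamma)$ is its edge set, $L_i$ the length of $e_i$. $r(x,y)$ is the effective resistance (edges as resistors of resistance equal to length). For an edge $e_i$ with end points $p_i,q_i$: if $\Gamma-e_i$ (interior of $e_i$ deleted) is connected, $R_i$ is the effective resistance between $p_i,q_i$ in $\Gamma-e_i$, and $R_{a_i,p}=\hat j_{p_i}(p,q_i)$, $R_{b_i,p}=\hat j_{q_i}(p,p_i)$ with $\hat j_z(x,y)$ the voltage function of $\Gamma-e_i$ (potential at $x$ when unit current enters at $y$, exits at $z$, potential $0$ at $z$), so $R_{a_i,p}+R_{b_i,p}=R_i$; if $e_i$ is a bridge, $R_{a_i,p}=0,R_{b_i,p}=R_i$ for $p$ in the component of $\Gamma-e_i$ containing $p_i$ and $R_{a_i,p}=R_i,R_{b_i,p}=0$ otherwise, and every expression involving $R_i$ is interpreted as its limit as $R_i\to\infty$; for a self-loop $R_i=0$. $Kf(\Gamma)=\frac12\sum_{p,q\in V(\Gamma)}r(p,q)$. $\overline{\Gamma}_i$ is obtained by contracting $e_i$ to a point (vertex set the image of $V(\Gamma)$); $\overline{\Gamma}_{i_1,\dots,i_k}$ is obtained by successively contracting $e_{i_1}\in E(\Gamma)$, then $e_{i_2}\in E(\overline\Gamma_{i_1})$, etc.; the quantities $L_{i_j},R_{i_j}$ are computed in the graph $\overline{\Gamma}_{i_1,\dots,i_{j-1}}$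 in which $e_{i_j}$ is contracted. The contraction is admissible if at each step the contracted edge has distinct end points (is not a self-loop); self-loop terms vanish anyway since $R=0$. For a fixed vertex $p$ (the value is independent of $p$), $y(\Gamma)=\frac14\sum_{e_i}\frac{L_iR_i^2}{(L_i+R_i)^2}+\frac34\sum_{e_i}\frac{L_i(R_{a_i,p}-R_{b_i,p})^2}{(L_i+R_i)^2}$. *)

theory Defs
  imports Complex_Main
begin

text \<open>A metrized graph is modelled by its combinatorial model: a finite nonempty
vertex set, a finite set of edges (multiple edges and self-loops allowed), each
edge having an ordered pair of end points and a positive length.\<close>

record ('a, 'b) mgraph =
  verts :: "'a set"
  edges :: "'b set"
  ends  :: "'b \<Rightarrow> 'a \<times> 'a"
  len   :: "'b \<Rightarrow> real"

definition adj :: "('a, 'b) mgraph \<Rightarrow> ('a \<times> 'a) set" where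
  "adj G = {(x, y). \<exists>e\<in>edges G. ends G e = (x, y) \<or> ends G e = (y, x)}"

definition connected_mg :: "('a, 'b) mgraph \<Rightarrow> bool" where
  "connected_mg G \<longleftrightarrow> (\<forall>x\<in>verts G. \<forall>y\<in>verts G. (x, y) \<in> (adj G)\<^sup>*)"

definition metrized_graph :: "('a, 'b) mgraph \<Rightarrow> bool" where
  "metrized_graph G \<longleftrightarrow> finite (verts G) \<and> verts G \<noteq> {} \<and> finite (edges G)
     \<and> (\<forall>e\<in>edges G. fst (ends G e) \<in> verts G \<and> snd (ends G e) \<in> verts G \<and> len G e > 0)
     \<and> connected_mg G"

text \<open>Net current flowing out of vertex w into the network for potential f
(edges are resistors of resistance equal to their length).\<close>
definition outflow :: "('a, 'b) mgraph \<Rightarrow> ('a \<Rightarrow> real) \<Rightarrow> 'a \<Rightarrow> real" where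
  "outflow G f w = (\<Sum>e\<in>edges G.
      (if fst (ends G e) = w then (f w - f (snd (ends G e))) / len G e else 0)
    + (if snd (ends G e) = w then (f w - f (fst (ends G e))) / len G e else 0))"

text \<open>Voltage function: volt G z y x = j_z(x,y), the potential at x when unit
current enters at y and exits at z, with potential 0 at z.\<close>
definition volt :: "('a, 'b) mgraph \<Rightarrow> 'a \<Rightarrow> 'a \<Rightarrow> 'a \<Rightarrow> real" where
  "volt G z y = (THE f. (\<forall>x. x \<notin> verts G \<longrightarrow> f x = 0) \<and> f z = 0 \<and>
      (\<forall>w\<in>verts G. outflow G f w = (if w = y then 1 else 0) - (if w = z then 1 else 0)))"

text \<open>Effective resistance r(x,y) = j_x(y,y).\<close>
definition resist :: "('a, 'b) mgraph \<Rightarrow> 'a \<Rightarrow> 'a \<Rightarrow> real" where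
  "resist G x y = volt G x y y"

definition Kf :: "('a, 'b) mgraph \<Rightarrow> real" where
  "Kf G = (1/2) * (\<Sum>p\<in>verts G. \<Sum>q\<in>verts G. resist G p q)"

text \<open>Gamma minus the interior of edge e.\<close>
definition delete_edge :: "('a, 'b) mgraph \<Rightarrow> 'b \<Rightarrow> ('a, 'b) mgraph" where
  "delete_edge G e = G\<lparr>edges := edges G - {e}\<rparr>"

definition is_bridge :: "('a, 'b) mgraph \<Rightarrow> 'b \<Rightarrow> bool" where
  "is_bridge G e \<longleftrightarrow> \<not> connected_mg (delete_edge G e)"

text \<open>R_i (meaningful for non-bridges; for a self-loop it is 0).\<close>
definition Rdel :: "('a, 'b) mgraph \<Rightarrow> 'b \<Rightarrow> real" where
  "Rdel G e = resist (delete_edge G e) (fst (ends G e)) (snd (ends G e))"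

text \<open>R_{a_i,p} = j_{p_i}(p,q_i) and R_{b_i,p} = j_{q_i}(p,p_i) in Gamma - e_i.\<close>
definition Ra :: "('a, 'b) mgraph \<Rightarrow> 'b \<Rightarrow> 'a \<Rightarrow> real" where
  "Ra G e p = volt (delete_edge G e) (fst (ends G e)) (snd (ends G e)) p"

definition Rb :: "('a, 'b) mgraph \<Rightarrow> 'b \<Rightarrow> 'a \<Rightarrow> real" where
  "Rb G e p = volt (delete_edge G e) (snd (ends G e)) (fst (ends G e)) p"

text \<open>The factor R_i/(L_i+R_i); for a bridge this is its limit 1 as R_i \<rightarrow> \<infinity>.\<close>
definition ratio :: "('a, 'b) mgraph \<Rightarrow> 'b \<Rightarrow> real" where
  "ratio G e = (if is_bridge G e then 1 else Rdel G e / (len G e + Rdel G e))"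

text \<open>The two summands of y(Gamma) for an edge; for a bridge (where
R_{a_i,p}-R_{b_i,p} = \<plusminus>R_i) both tend to L_i as R_i \<rightarrow> \<infinity>.\<close>
definition yterm1 :: "('a, 'b) mgraph \<Rightarrow> 'b \<Rightarrow> real" where
  "yterm1 G e = (if is_bridge G e then len G e
     else len G e * (Rdel G e)\<^sup>2 / (len G e + Rdel G e)\<^sup>2)"

definition yterm2 :: "('a, 'b) mgraph \<Rightarrow> 'b \<Rightarrow> 'a \<Rightarrow> real" where
  "yterm2 G e p = (if is_bridge G e then len G e
     else len G e * (Ra G e p - Rb G e p)\<^sup>2 / (len G e + Rdel G e)\<^sup>2)"

definition yinv :: "('a, 'b) mgraph \<Rightarrow> 'a \<Rightarrow> real" where
  "yinv G p = (1/4) * (\<Sum>e\<in>edges G. yterm1 G e) + (3/4) * (\<Sum>e\<in>edges G. yterm2 G e p)"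

text \<open>Contraction of an edge e with end points (a,b): b is identified with a.\<close>
definition contract :: "('a, 'b) mgraph \<Rightarrow> 'b \<Rightarrow> ('a, 'b) mgraph" where
  "contract G e =
    (let a = fst (ends G e); b = snd (ends G e); \<sigma> = (\<lambda>x. if x = b then a else x) in
     \<lparr>verts = \<sigma> ` verts G, edges = edges G - {e},
      ends = (\<lambda>d. (\<sigma> (fst (ends G d)), \<sigma> (snd (ends G d)))), len = len G\<rparr>)"

definition nonloop_edges :: "('a, 'b) mgraph \<Rightarrow> 'b set" where
  "nonloop_edges G = {e \<in> edges G. fst (ends G e) \<noteq> snd (ends G e)}"

text \<open>The k-fold nested sum over admissible contractions
  sum_{i1} R/(L+R) sum_{i2} R/(L+R) ... sum_{ik} R/(L+R) Kf(contracted graph).\<close>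
fun csum :: "nat \<Rightarrow> ('a, 'b) mgraph \<Rightarrow> real" where
  "csum 0 G = Kf G"
| "csum (Suc k) G = (\<Sum>e\<in>nonloop_edges G. ratio G e * csum k (contract G e))"

end

theory Submission
  imports Defs
begin

text \<open>
  Let \<open>v\<close> be the number of vertices. Everything follows by induction on \<open>k\<close> from the two identities
  \<open>\<Sum>\<^sub>e R/(L+R) Kf(\<Gamma>/e) = (v - 4) Kf(\<Gamma>) + v y(\<Gamma>)\<close> and
  \<open>\<Sum>\<^sub>e R/(L+R) y(\<Gamma>/e) = (v - 2) y(\<Gamma>)\<close>.
  In terms of the resistance function \<open>r\<close> of \<open>\<Gamma>\<close> itself, for an edge \<open>e\<close> with end points \<open>a, b\<close>
  one has \<open>R/(L+R) = r(a,b)/L\<close>,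
  \<open>y(\<Gamma>) = 1/4 \<Sum>\<^sub>e r(a,b)\<^sup>2/L + 3/4 \<Sum>\<^sub>e (r(a,p) - r(b,p))\<^sup>2/L\<close>, and contracting \<open>e\<close> changes \<open>r(x,y)\<close> to
  \<open>r(x,y) - (w(x) - w(y))\<^sup>2/r(a,b)\<close> with \<open>w = (r(\<cdot>,a) - r(\<cdot>,b))/2\<close>, so the factor \<open>r(a,b)\<close> cancels
  the denominators. The resulting sums are evaluated with Green's identity, using that the Laplacian
  of \<open>r(\<cdot>,p)\<close> is \<open>\<kappa> - 2\<delta>\<^sub>p\<close> with \<open>\<kappa>\<close> independent of \<open>p\<close>.
\<close>

section \<open>Solvability of square linear systems\<close>

text \<open>Gaussian elimination by induction on the unknowns: eliminating one unknown with a pivot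
  row leaves a smaller square system that again has trivial kernel.\<close>

lemma square_system_solvable:
  fixes A :: "'i \<Rightarrow> 'j \<Rightarrow> real"
  assumes "finite S" "finite T" "card T = card S"
    and "\<And>x. (\<And>i. i \<in> T \<Longrightarrow> (\<Sum>j\<in>S. A i j * x j) = 0) \<Longrightarrow> \<forall>j\<in>S. x j = 0"
  shows "\<exists>x. \<forall>i\<in>T. (\<Sum>j\<in>S. A i j * x j) = b i"
  using assms
proof (induction S arbitrary: T A b rule: finite_induct)
  case empty
  then show ?case by simp
next
  case (insert s S)
  have "\<exists>t\<in>T. A t s \<noteq> 0"
  proof (rule ccontr)
    assume "\<not> ?thesis"
    \<comment> \<open>A zero column \<open>s\<close> would put the unit vector at \<open>s\<close>
      into the kernel.\<close>
    then have "\<And>i. i \<in> T \<Longrightarrow> (\<Sum>j\<in>insert s S. A i j * (if j = s then 1 else 0)) = 0"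
      by (auto intro!: sum.neutral)
    from insert.prems(3)[OF this] show False by auto
  qed
  then obtain t where t: "t \<in> T" "A t s \<noteq> 0" by blast
  \<comment> \<open>\<open>A'\<close> is the matrix after elimination with pivot
    \<open>A t s\<close>; \<open>lift x c\<close> is back substitution, choosing the value at
    \<open>s\<close> so that row \<open>t\<close> yields \<open>c\<close>.\<close>
  define A' where "A' i j = A i j - A i s * A t j / A t s" for i j
  define lift where "lift x c = (\<lambda>j. if j = s then (c - (\<Sum>j\<in>S. A t j * x j)) / A t s else x j)" for x c
  have notin: "j \<noteq> s" if "j \<in> S" for j using that insert.hyps by auto
  have lift: "(\<Sum>j\<in>insert s S. A i j * lift x c j)
      = A i s * c / A t s + (\<Sum>j\<in>S. A' i j * x j)" for i x c
  proof -
    have "(\<Sum>j\<in>S. A i j * lift x c j) = (\<Sum>j\<in>S. A i j * x j)"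
      by (rule sum.cong) (auto simp: lift_def notin)
    moreover have "(\<Sum>j\<in>S. A' i j * x j)
        = (\<Sum>j\<in>S. A i j * x j) - A i s / A t s * (\<Sum>j\<in>S. A t j * x j)"
      by (simp add: A'_def algebra_simps sum_subtractf sum_distrib_left)
    ultimately show ?thesis
      using insert.hyps by (simp add: lift_def diff_divide_distrib right_diff_distrib)
  qed
  have pivot: "A' t j = 0" for j using t by (simp add: A'_def)
  have "\<exists>x. \<forall>i\<in>T - {t}. (\<Sum>j\<in>S. A' i j * x j) = b i - A i s * b t / A t s"
  proof (rule insert.IH)
    show "card (T - {t}) = card S" using insert.prems t insert.hyps by simp
  next
    fix x assume x: "\<And>i. i \<in> T - {t} \<Longrightarrow> (\<Sum>j\<in>S. A' i j * x j) = 0"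
    have "(\<Sum>j\<in>insert s S. A i j * lift x 0 j) = 0" if "i \<in> T" for i
      using x[of i] that by (cases "i = t") (simp_all add: lift pivot)
    from insert.prems(3)[OF this] show "\<forall>j\<in>S. x j = 0"
      by (auto simp: lift_def notin split: if_splits)
  qed (use insert.prems in auto)
  then obtain x where x: "\<And>i. i \<in> T - {t} \<Longrightarrow> (\<Sum>j\<in>S. A' i j * x j) = b i - A i s * b t / A t s"
    by blast
  have "(\<Sum>j\<in>insert s S. A i j * lift x (b t) j) = b i" if "i \<in> T" for i
    using x[of i] that t by (cases "i = t") (simp_all add: lift pivot)
  then show ?case by blast
qed

subsection \<open>Dirichlet energy and resistance\<close>

definition energy :: "('a, 'b) mgraph \<Rightarrow> ('a \<Rightarrow> real) \<Rightarrow> ('a \<Rightarrow> real) \<Rightarrow> real" where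
  "energy G f h = (\<Sum>e\<in>edges G. (f (fst (ends G e)) - f (snd (ends G e)))
      * (h (fst (ends G e)) - h (snd (ends G e))) / len G e)"

lemma energy_commute: "energy G f h = energy G h f"
  by (simp add: energy_def mult.commute)

lemma energy_diff_right: "energy G f (\<lambda>x. h x - k x) = energy G f h - energy G f k"
  by (simp add: energy_def algebra_simps diff_divide_distrib add_divide_distrib sum_subtractf sum.distrib)

lemma energy_add_right: "energy G f (\<lambda>x. h x + k x) = energy G f h + energy G f k"
  by (simp add: energy_def algebra_simps diff_divide_distrib add_divide_distrib sum_subtractf sum.distrib)

lemma energy_scale_right: "energy G f (\<lambda>x. c * h x) = c * energy G f h"
  by (simp add: energy_def algebra_simps diff_divide_distrib sum_subtractf sum_distrib_left)

lemma energy_const_right: "energy G f (\<lambda>x. c) = 0"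
  by (simp add: energy_def)

lemma energy_diff_left: "energy G (\<lambda>x. h x - k x) f = energy G h f - energy G k f"
  by (metis energy_commute energy_diff_right)

lemma energy_scale_left: "energy G (\<lambda>x. c * h x) f = c * energy G h f"
  by (metis energy_commute energy_scale_right)

lemma energy_const_left: "energy G (\<lambda>x. c) f = 0"
  by (simp add: energy_def)

lemmas energy_linear = energy_diff_right energy_add_right energy_scale_right energy_const_right
  energy_diff_left energy_scale_left energy_const_left

lemma adj_sym: "sym (adj G)"
  by (auto simp: adj_def sym_def)

locale metrized =
  fixes G :: "('a, 'b) mgraph"
  assumes metrized: "metrized_graph G"
begin

abbreviation "V \<equiv> verts G"
abbreviation "E \<equiv> edges G"
abbreviation "src e \<equiv> fst (ends G e)"
abbreviation "tgt e \<equiv> snd (ends G e)"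
abbreviation "r \<equiv> resist G"

lemma finite_V [simp, intro]: "finite V" and finite_E [simp, intro]: "finite E"
  and V_nonempty: "V \<noteq> {}"
  and src_V [simp]: "e \<in> E \<Longrightarrow> src e \<in> V" and tgt_V [simp]: "e \<in> E \<Longrightarrow> tgt e \<in> V"
  and len_pos: "e \<in> E \<Longrightarrow> len G e > 0" and connected: "connected_mg G"
  using metrized by (auto simp: metrized_graph_def)

lemma len_nonzero [simp]: "e \<in> E \<Longrightarrow> len G e \<noteq> 0"
  using len_pos[of e] by simp

lemma energy_cong:
  assumes "\<And>x. x \<in> V \<Longrightarrow> f x = f' x" "\<And>x. x \<in> V \<Longrightarrow> h x = h' x"
  shows "energy G f h = energy G f' h'"
  unfolding energy_def by (rule sum.cong) (simp_all add: assms)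

text \<open>Discrete integration by parts: after exchanging the sums, each edge contributes at its
  source and at its target.\<close>

lemma green_identity: "(\<Sum>w\<in>V. f w * outflow G h w) = energy G f h"
proof -
  have "(\<Sum>w\<in>V. f w * outflow G h w) = (\<Sum>e\<in>E. \<Sum>w\<in>V. f w *
      ((if src e = w then (h w - h (tgt e)) / len G e else 0)
     + (if tgt e = w then (h w - h (src e)) / len G e else 0)))"
    unfolding outflow_def sum_distrib_left by (rule sum.swap)
  also have "\<dots> = energy G f h"
    unfolding energy_def
  proof (rule sum.cong[OF refl])
    fix e assume e: "e \<in> E"
    have "(\<Sum>w\<in>V. f w * ((if src e = w then (h w - h (tgt e)) / len G e else 0)
        + (if tgt e = w then (h w - h (src e)) / len G e else 0)))
      = (\<Sum>w\<in>V. if src e = w then f w * (h w - h (tgt e)) / len G e else 0)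
        + (\<Sum>w\<in>V. if tgt e = w then f w * (h w - h (src e)) / len G e else 0)"
      unfolding sum.distrib[symmetric] by (rule sum.cong) (auto simp: distrib_left)
    also have "\<dots> = (f (src e) - f (tgt e)) * (h (src e) - h (tgt e)) / len G e"
      using e by (simp add: field_simps)
    finally show "(\<Sum>w\<in>V. f w * ((if src e = w then (h w - h (tgt e)) / len G e else 0)
        + (if tgt e = w then (h w - h (src e)) / len G e else 0)))
      = (f (src e) - f (tgt e)) * (h (src e) - h (tgt e)) / len G e" .
  qed
  finally show ?thesis .
qed

lemma energy_nonneg: "energy G f f \<ge> 0"
  unfolding energy_def by (rule sum_nonneg) (auto intro!: divide_nonneg_pos len_pos)

text \<open>A sum of nonnegative edge terms vanishes only termwise, so \<open>f\<close> agrees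
  across every edge and hence along paths.\<close>

lemma energy_zero_imp_const:
  assumes "energy G f f = 0" "x \<in> V" "y \<in> V"
  shows "f x = f y"
proof -
  have "(f (src e) - f (tgt e)) * (f (src e) - f (tgt e)) / len G e = 0" if "e \<in> E" for e
    using assms(1) that unfolding energy_def
    by (subst (asm) sum_nonneg_eq_0_iff) (auto intro!: divide_nonneg_pos len_pos)
  then have edge: "f (src e) = f (tgt e)" if "e \<in> E" for e using that by fastforce
  have "(x, y) \<in> (adj G)\<^sup>*" using connected assms by (auto simp: connected_mg_def)
  then show ?thesis
  proof induction
    case (step y z)
    then show ?case using edge by (fastforce simp: adj_def)
  qed simp
qed

lemma outflow_zero_imp_const:
  assumes "\<And>w. w \<in> V \<Longrightarrow> outflow G f w = 0" "x \<in> V" "y \<in> V"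
  shows "f x = f y"
proof (rule energy_zero_imp_const[OF _ assms(2,3)])
  show "energy G f f = 0" unfolding green_identity[symmetric] by (simp add: assms(1))
qed

lemma sum_outflow: "(\<Sum>w\<in>V. outflow G f w) = 0"
  using green_identity[of "\<lambda>_. 1" f] by (simp add: energy_const_left)

text \<open>Linearity of the Laplacian, in the matrix form that
  \<open>square_system_solvable\<close> expects.\<close>

lemma outflow_superpose:
  assumes "finite S"
  shows "outflow G (\<lambda>x. \<Sum>j\<in>S. c j * u j x) w = (\<Sum>j\<in>S. outflow G (u j) w * c j)"
proof -
  have "outflow G (\<lambda>x. \<Sum>j\<in>S. c j * u j x) w = (\<Sum>e\<in>E. \<Sum>j\<in>S.
     ((if src e = w then (u j w - u j (tgt e)) / len G e else 0)
    + (if tgt e = w then (u j w - u j (src e)) / len G e else 0)) * c j)"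
    unfolding outflow_def
    by (rule sum.cong) (auto simp: sum_subtractf[symmetric] sum_divide_distrib sum.distrib[symmetric]
        algebra_simps diff_divide_distrib intro!: sum.cong)
  also have "\<dots> = (\<Sum>j\<in>S. outflow G (u j) w * c j)"
    unfolding outflow_def sum_distrib_right by (rule sum.swap)
  finally show ?thesis .
qed

section \<open>Existence and uniqueness of potentials\<close>

text \<open>Grounding \<open>z\<close> removes its row and column from the Laplacian; the remaining
  square system has trivial kernel because a function without outflow is constant.\<close>

lemma poisson_solvable:
  assumes z: "z \<in> V" and b: "(\<Sum>w\<in>V. b w) = 0"
  shows "\<exists>f. (\<forall>x. x \<notin> V \<longrightarrow> f x = 0) \<and> f z = 0 \<and> (\<forall>w\<in>V. outflow G f w = b w)"
proof -
  define F where "F c = (\<lambda>x. \<Sum>j\<in>V - {z}. c j * (if x = j then 1 else 0 :: real))" for c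
  have F: "F c x = (if x \<in> V - {z} then c x else 0)" for c x
    unfolding F_def by (simp add: if_distrib cong: if_cong)
  have out: "outflow G (F c) w
      = (\<Sum>j\<in>V - {z}. outflow G (\<lambda>x. if x = j then 1 else 0) w * c j)" for c w
    unfolding F_def by (rule outflow_superpose) simp
  have "\<exists>c. \<forall>w\<in>V - {z}. (\<Sum>j\<in>V - {z}. outflow G (\<lambda>x. if x = j then 1 else 0) w * c j) = b w"
  proof (rule square_system_solvable)
    fix c
    assume "\<And>i. i \<in> V - {z} \<Longrightarrow> (\<Sum>j\<in>V - {z}. outflow G (\<lambda>x. if x = j then 1 else 0) i * c j) = 0"
    then have 1: "outflow G (F c) w = 0" if "w \<in> V - {z}" for w using that out by simp
    moreover have "outflow G (F c) z = 0"
      using sum_outflow[of "F c"] 1 z by (simp add: sum.remove[of V z])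
    ultimately have "F c x = F c z" if "x \<in> V" for x
      using that z by (intro outflow_zero_imp_const) auto
    then show "\<forall>j\<in>V - {z}. c j = 0" using F[of c] by (metis DiffD1 DiffD2 insertI1)
  qed auto
  then obtain c where c: "outflow G (F c) w = b w" if "w \<in> V - {z}" for w using out by auto
  \<comment> \<open>The equation at \<open>z\<close> was left out of the system; it follows because
    both sides have total 0 over \<open>V\<close>.\<close>
  moreover have "outflow G (F c) z = b z"
  proof -
    have "(\<Sum>w\<in>V - {z}. outflow G (F c) w) = (\<Sum>w\<in>V - {z}. b w)" using c by (intro sum.cong) auto
    then show ?thesis using sum_outflow[of "F c"] b z by (simp add: sum.remove[of V z])
  qed
  ultimately have "\<forall>w\<in>V. outflow G (F c) w = b w" by auto
  then show ?thesis by (intro exI[of _ "F c"]) (auto simp: F)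
qed

text \<open>The reproducing property: a dipole potential represents \<open>h y - h z\<close> in the
  energy form. Later arguments about potentials mostly go through it.\<close>

lemma energy_dipole:
  assumes "y \<in> V" "z \<in> V"
    and "\<forall>w\<in>V. outflow G f w = (if w = y then 1 else 0) - (if w = z then 1 else 0)"
  shows "energy G h f = h y - h z"
proof -
  have "energy G h f = (\<Sum>w\<in>V. (if w = y then h w else 0) - (if w = z then h w else 0))"
    unfolding green_identity[symmetric] by (rule sum.cong) (use assms(3) in auto)
  then show ?thesis using assms(1,2) by (simp add: sum_subtractf)
qed

lemma dipole_unique:
  assumes "\<And>h. energy G h f = h y - h z" "\<And>h. energy G h f' = h y - h z" "x \<in> V" "z \<in> V"
  shows "f x - f z = f' x - f' z"
proof -
  have "energy G (\<lambda>x. f x - f' x) (\<lambda>x. f x - f' x) = 0"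
    by (simp add: energy_diff_right assms)
  from energy_zero_imp_const[OF this assms(3,4)] show ?thesis by simp
qed

lemma volt_characterization:
  assumes "y \<in> V" "z \<in> V"
  shows "(\<forall>x. x \<notin> V \<longrightarrow> volt G z y x = 0) \<and> volt G z y z = 0 \<and>
      (\<forall>w\<in>V. outflow G (volt G z y) w = (if w = y then 1 else 0) - (if w = z then 1 else 0))"
proof -
  let ?P = "\<lambda>f. (\<forall>x. x \<notin> V \<longrightarrow> f x = 0) \<and> f z = 0 \<and>
      (\<forall>w\<in>V. outflow G f w = (if w = y then 1 else 0) - (if w = z then 1 else 0))"
  have "\<exists>f. ?P f"
    using assms by (intro poisson_solvable) (simp_all add: sum_subtractf)
  moreover have "f = f'" if "?P f" "?P f'" for f f'
  proof
    fix x
    have "f x - f z = f' x - f' z" if "x \<in> V"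
      by (rule dipole_unique[OF _ _ that assms(2), of f y f'])
        (use \<open>?P f\<close> \<open>?P f'\<close> assms in \<open>auto intro: energy_dipole\<close>)
    then show "f x = f' x" using that by (cases "x \<in> V") auto
  qed
  ultimately have "\<exists>!f. ?P f" by blast
  from theI'[OF this] show ?thesis unfolding volt_def .
qed

lemma volt_base [simp]: "y \<in> V \<Longrightarrow> z \<in> V \<Longrightarrow> volt G z y z = 0"
  using volt_characterization by blast

lemma energy_volt: "y \<in> V \<Longrightarrow> z \<in> V \<Longrightarrow> energy G h (volt G z y) = h y - h z"
  using volt_characterization by (blast intro: energy_dipole)

lemma volt_eqI:
  assumes "\<And>h. energy G h f = h y - h z" "y \<in> V" "z \<in> V" "x \<in> V"
  shows "volt G z y x = f x - f z"
  using dipole_unique[of "volt G z y" y z f x] assms by (simp add: energy_volt)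

section \<open>Reciprocity and the resistance function\<close>

text \<open>By the reproducing property both sides are the energy pairing of the same two voltage
  functions, which is symmetric.\<close>

lemma volt_commute:
  assumes "x \<in> V" "y \<in> V" "z \<in> V"
  shows "volt G z y x = volt G z x y"
  using energy_volt[of y z "volt G z x"] energy_volt[of x z "volt G z y"] assms
  by (simp add: energy_commute)

text \<open>The dipoles from \<open>y\<close> to \<open>z\<close> and from \<open>w\<close> to
  \<open>z\<close> differ by a dipole from \<open>y\<close> to \<open>w\<close>.\<close>

lemma volt_change_base:
  assumes "w \<in> V" "x \<in> V" "y \<in> V" "z \<in> V"
  shows "volt G w y x = volt G z y x - volt G z w x - (volt G z y w - volt G z w w)"
  using assms by (intro volt_eqI) (simp_all add: energy_diff_right energy_volt)

lemma resist_conv_volt: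
  assumes "x \<in> V" "y \<in> V" "z \<in> V"
  shows "r x y = volt G z x x + volt G z y y - 2 * volt G z y x"
  unfolding resist_def using assms volt_change_base[of x y y z] volt_commute[of x y z] by simp

lemma resist_self [simp]: "x \<in> V \<Longrightarrow> r x x = 0"
  by (simp add: resist_def)

lemma resist_commute: "x \<in> V \<Longrightarrow> y \<in> V \<Longrightarrow> r x y = r y x"
  using resist_conv_volt[of x y x] resist_conv_volt[of y x x] volt_commute[of y x x] by simp

text \<open>A Gromov product formula; it lets all later computations be expressed in
  \<open>r\<close> alone.\<close>

lemma volt_conv_resist:
  assumes "x \<in> V" "y \<in> V" "z \<in> V"
  shows "volt G z y x = (r x z + r z y - r x y) / 2"
  using assms resist_conv_volt[of x y z] resist_conv_volt[of x z z] resist_conv_volt[of z y z]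
    volt_commute[of z x z] volt_commute[of z y z] by simp

lemma resist_nonneg: "x \<in> V \<Longrightarrow> y \<in> V \<Longrightarrow> r x y \<ge> 0"
  using energy_nonneg[of "volt G x y"] by (simp add: resist_def energy_volt)

lemma resist_pos:
  assumes "x \<in> V" "y \<in> V" "x \<noteq> y"
  shows "r x y > 0"
proof -
  have "r x y \<noteq> 0"
  proof
    assume "r x y = 0"
    then have 0: "energy G (volt G x y) (volt G x y) = 0"
      using assms by (simp add: energy_volt resist_def)
    have "volt G x y w = 0" if "w \<in> V" for w
      using energy_zero_imp_const[OF 0 that assms(1)] assms by simp
    \<comment> \<open>The indicator of \<open>y\<close> as test function pairs to 1 with the voltage
      function, but to 0 with a constant.\<close>
    then have "energy G (\<lambda>w. if w = y then 1 else 0) (volt G x y)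
        = energy G (\<lambda>w. if w = y then 1 else 0) (\<lambda>_. 0)"
      by (intro energy_cong) auto
    then show False using assms by (simp add: energy_volt energy_const_right)
  qed
  then show ?thesis using resist_nonneg[of x y] assms by simp
qed

text \<open>Up to an additive constant, \<open>r x p - r x q\<close> is -2 times the voltage
  function \<open>volt G q p\<close>.\<close>

lemma energy_resist_diff:
  assumes "p \<in> V" "q \<in> V"
  shows "energy G f (\<lambda>x. r x p - r x q) = -2 * (f p - f q)"
proof -
  have "energy G f (\<lambda>x. r x p - r x q) = energy G f (\<lambda>x. r q p - 2 * volt G q p x)"
    using assms by (intro energy_cong) (simp_all add: volt_conv_resist resist_commute field_simps)
  then show ?thesis using assms by (simp add: energy_linear energy_volt)
qed

section \<open>The Laplacian of the resistance function and Foster's theorem\<close>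

abbreviation \<rho> where "\<rho> e \<equiv> resist G (src e) (tgt e)"

lemma outflow_conv_energy: "w \<in> V \<Longrightarrow> outflow G f w = energy G (\<lambda>x. if x = w then 1 else 0) f"
  unfolding green_identity[symmetric] by (simp add: if_distrib[of "\<lambda>t. t * _"] cong: if_cong)

text \<open>Up to the factor 2, the discrete canonical measure: the part of the outflow of
  \<open>r(\<cdot>, p)\<close> that does not depend on \<open>p\<close>.\<close>

definition \<kappa> :: "'a \<Rightarrow> real" where
  "\<kappa> w = outflow G (\<lambda>x. r x w) w + 2"

lemma outflow_resist:
  assumes "p \<in> V" "w \<in> V"
  shows "outflow G (\<lambda>x. r x p) w = \<kappa> w - (if w = p then 2 else 0)"
  using energy_resist_diff[OF assms, of "\<lambda>x. if x = w then 1 else 0"] assms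
  by (auto simp: \<kappa>_def outflow_conv_energy energy_diff_right)

lemma energy_resist:
  assumes "p \<in> V"
  shows "energy G f (\<lambda>x. r x p) = (\<Sum>w\<in>V. f w * \<kappa> w) - 2 * f p"
proof -
  have "energy G f (\<lambda>x. r x p) = (\<Sum>w\<in>V. f w * \<kappa> w - (if w = p then 2 * f w else 0))"
    unfolding green_identity[symmetric]
    by (rule sum.cong) (use assms in \<open>auto simp: outflow_resist algebra_simps\<close>)
  then show ?thesis using assms by (simp add: sum_subtractf)
qed

lemma sum_\<kappa>: "(\<Sum>w\<in>V. \<kappa> w) = 2"
proof -
  obtain p where "p \<in> V" using V_nonempty by blast
  from energy_resist[OF this, of "\<lambda>_. 1"] show ?thesis by (simp add: energy_const_left)
qed

lemma energy_resist_self: "p \<in> V \<Longrightarrow> energy G (\<lambda>x. r x p) (\<lambda>x. r x p) = (\<Sum>w\<in>V. r w p * \<kappa> w)"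
  by (simp add: energy_resist)

text \<open>The mixed energy of \<open>r(., p)\<close> and \<open>r(., q)\<close>, evaluated with
  either one as the potential, gives the same correction \<open>2 * r p q\<close>. This is why
  \<open>yinv\<close> does not depend on its base point.\<close>

lemma energy_resist_indep:
  assumes "p \<in> V" "q \<in> V"
  shows "energy G (\<lambda>x. r x p) (\<lambda>x. r x p) = energy G (\<lambda>x. r x q) (\<lambda>x. r x q)"
  using energy_resist[OF assms(1), of "\<lambda>x. r x q"] energy_resist[OF assms(2), of "\<lambda>x. r x p"]
  by (simp add: energy_commute energy_resist_self assms resist_commute)

text \<open>Only edges at \<open>w\<close> see the indicator of \<open>w\<close>, and since
  \<open>r w w = 0\<close> the difference of \<open>r(., w)\<close> along such an edge is its
  \<open>\<rho>\<close> up to sign.\<close>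

lemma \<kappa>_conv_edges:
  assumes "w \<in> V"
  shows "(\<Sum>e\<in>E. ((if src e = w then 1 else 0) + (if tgt e = w then 1 else 0)) * \<rho> e / len G e)
    = 2 - \<kappa> w"
proof -
  have "2 - \<kappa> w = - energy G (\<lambda>x. if x = w then 1 else 0) (\<lambda>x. r x w)"
    using assms by (simp add: \<kappa>_def outflow_conv_energy)
  also have "\<dots> = (\<Sum>e\<in>E. ((if src e = w then 1 else 0) + (if tgt e = w then 1 else 0)) * \<rho> e / len G e)"
    unfolding energy_def sum_negf[symmetric]
    by (rule sum.cong) (use assms in \<open>auto simp: resist_commute\<close>)
  finally show ?thesis by simp
qed

lemma sum_edges_resist:
  "(\<Sum>e\<in>E. (f (src e) + f (tgt e)) * \<rho> e / len G e) = (\<Sum>w\<in>V. f w * (2 - \<kappa> w))"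
proof -
  have "(\<Sum>w\<in>V. f w * (2 - \<kappa> w)) = (\<Sum>e\<in>E. \<Sum>w\<in>V. f w *
      (((if src e = w then 1 else 0) + (if tgt e = w then 1 else 0)) * \<rho> e / len G e))"
    by (simp add: \<kappa>_conv_edges[symmetric] sum_distrib_left) (rule sum.swap)
  also have "\<dots> = (\<Sum>e\<in>E. (f (src e) + f (tgt e)) * \<rho> e / len G e)"
  proof (rule sum.cong[OF refl])
    fix e assume e: "e \<in> E"
    have "(\<Sum>w\<in>V. f w * (((if src e = w then 1 else 0) + (if tgt e = w then 1 else 0)) * \<rho> e / len G e))
      = (\<Sum>w\<in>V. if src e = w then f w * \<rho> e / len G e else 0)
        + (\<Sum>w\<in>V. if tgt e = w then f w * \<rho> e / len G e else 0)"
      unfolding sum.distrib[symmetric] by (rule sum.cong) (auto simp: distrib_left)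
    also have "\<dots> = (f (src e) + f (tgt e)) * \<rho> e / len G e"
      using e by (simp add: field_simps)
    finally show "(\<Sum>w\<in>V. f w * (((if src e = w then 1 else 0) + (if tgt e = w then 1 else 0)) * \<rho> e / len G e))
      = (f (src e) + f (tgt e)) * \<rho> e / len G e" .
  qed
  finally show ?thesis by simp
qed

text \<open>Foster's theorem: the constant weight 1 in \<open>sum_edges_resist\<close>, with the
  total mass 2 of \<open>\<kappa>\<close>.\<close>

lemma foster: "(\<Sum>e\<in>E. \<rho> e / len G e) = real (card V) - 1"
proof -
  have "2 * (\<Sum>e\<in>E. \<rho> e / len G e) = (\<Sum>w\<in>V. 2 - \<kappa> w)"
    using sum_edges_resist[of "\<lambda>_. 1"] by (simp add: sum_distrib_left)
  then show ?thesis by (simp add: sum_subtractf sum_\<kappa>)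
qed

lemma sum_edges_resist_vertex:
  assumes "x \<in> V"
  shows "(\<Sum>e\<in>E. (r (src e) x + r (tgt e) x) * \<rho> e / len G e)
    = 2 * (\<Sum>w\<in>V. r w x) - energy G (\<lambda>w. r w x) (\<lambda>w. r w x)"
  unfolding sum_edges_resist[of "\<lambda>w. r w x"] energy_resist_self[OF assms]
  by (simp add: right_diff_distrib sum_subtractf sum_distrib_left mult.commute[of _ 2])

subsection \<open>Deletion of an edge\<close>

lemma energy_delete:
  assumes "e \<in> E"
  shows "energy G f h = energy (delete_edge G e) f h
    + (f (src e) - f (tgt e)) * (h (src e) - h (tgt e)) / len G e"
  using assms by (simp add: energy_def delete_edge_def sum.remove[of E e])

lemma delete_metrized:
  assumes "\<not> is_bridge G e"
  shows "metrized (delete_edge G e)"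
  using assms metrized by (simp add: metrized_def is_bridge_def metrized_graph_def delete_edge_def)

text \<open>Restoring \<open>e\<close> leaves a dipole potential of the deleted graph a dipole:
  \<open>e\<close> carries the extra current \<open>Rdel / len\<close>, so only rescaling to unit
  current is needed.\<close>

lemma volt_conv_delete:
  assumes e: "e \<in> E" and nb: "\<not> is_bridge G e" and x: "x \<in> V"
  shows "volt G (src e) (tgt e) x = len G e / (len G e + Rdel G e) * Ra G e x"
    and "Rb G e x = Rdel G e - Ra G e x" and "Rdel G e \<ge> 0"
proof -
  interpret D: metrized "delete_edge G e" by (rule delete_metrized[OF nb])
  have V: "verts (delete_edge G e) = V" by (simp add: delete_edge_def)
  define f where "f = volt (delete_edge G e) (src e) (tgt e)"
  have f_src: "f (src e) = 0" and f_tgt: "f (tgt e) = Rdel G e" and Ra: "Ra G e x = f x" for x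
    using e D.volt_base[of "tgt e" "src e"] by (simp_all add: f_def Rdel_def resist_def Ra_def V)
  show R: "Rdel G e \<ge> 0" using D.resist_nonneg[of "src e" "tgt e"] e by (simp add: Rdel_def V)
  have fe: "energy (delete_edge G e) h f = h (tgt e) - h (src e)" for h
    unfolding f_def using e D.energy_volt[of "tgt e" "src e"] by (simp add: V)
  define c where "c = len G e / (len G e + Rdel G e)"
  have "energy G h (\<lambda>x. c * f x) = h (tgt e) - h (src e)" for h
  proof -
    have "energy G h f = (h (tgt e) - h (src e)) * ((len G e + Rdel G e) / len G e)"
      using energy_delete[OF e, of h f] len_pos[OF e] by (simp add: fe f_src f_tgt field_simps)
    moreover have "len G e + Rdel G e \<noteq> 0" using len_pos[OF e] R by simp
    ultimately show ?thesis using len_pos[OF e] by (simp only: energy_scale_right c_def) simp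
  qed
  from volt_eqI[OF this] show "volt G (src e) (tgt e) x = c * Ra G e x"
    using e x by (simp add: f_src Ra)
  \<comment> \<open>Reversing the current negates the potential; the base point then moves to
    \<open>tgt e\<close>.\<close>
  have "volt (delete_edge G e) (tgt e) (src e) x = - f x - - f (tgt e)"
  proof (rule D.volt_eqI)
    show "energy (delete_edge G e) h (\<lambda>x. - f x) = h (src e) - h (tgt e)" for h
      using energy_scale_right[of "delete_edge G e" h "-1" f] by (simp add: fe)
  qed (use e x V in auto)
  then show "Rb G e x = Rdel G e - Ra G e x" by (simp add: Rb_def Ra f_tgt)
qed

text \<open>All current passes through the bridge, so the potential is constant on each side of it
  and jumps by the length.\<close>

lemma bridge_volt:
  assumes e: "e \<in> E" and br: "is_bridge G e"
  obtains f where "\<And>x. x \<in> V \<Longrightarrow> volt G (src e) (tgt e) x = f x"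
    "\<And>x. f x = 0 \<or> f x = len G e" "f (tgt e) = len G e"
proof -
  define D where "D = (adj (delete_edge G e))\<^sup>*"
  have "sym D" unfolding D_def by (intro sym_rtrancl adj_sym)
  have tr: "(x, z) \<in> D" if "(x, y) \<in> D" "(y, z) \<in> D" for x y z
    using that unfolding D_def by (rule rtrancl_trans)
  have edge: "(src d, tgt d) \<in> D" if "d \<in> E" "d \<noteq> e" for d
    using that unfolding D_def by (intro r_into_rtrancl) (auto simp: adj_def delete_edge_def)
  \<comment> \<open>Otherwise every edge of \<open>G\<close>, including \<open>e\<close>, would join
    vertices already connected without \<open>e\<close>, and \<open>e\<close> would not be a
    bridge.\<close>
  have sep: "(tgt e, src e) \<notin> D"
  proof
    assume "(tgt e, src e) \<in> D"
    with edge \<open>sym D\<close> have "(src d, tgt d) \<in> D \<and> (tgt d, src d) \<in> D" if "d \<in> E" for d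
      using that by (metis symD)
    then have "adj G \<subseteq> D" by (fastforce simp: adj_def)
    then have "(adj G)\<^sup>* \<subseteq> D" unfolding D_def by (metis rtrancl_mono rtrancl_idemp)
    with connected have "connected_mg (delete_edge G e)"
      by (auto simp: connected_mg_def delete_edge_def D_def)
    with br show False by (simp add: is_bridge_def)
  qed
  define f where "f x = (if (tgt e, x) \<in> D then len G e else 0)" for x
  have f_tgt: "f (tgt e) = len G e" by (simp add: f_def D_def)
  have f_src: "f (src e) = 0" using sep by (simp add: f_def)
  have f_edge: "f (src d) = f (tgt d)" if "d \<in> E" "d \<noteq> e" for d
  proof -
    have "(tgt e, src d) \<in> D \<longleftrightarrow> (tgt e, tgt d) \<in> D"
      using edge[OF that] tr \<open>sym D\<close> by (metis symD)
    then show ?thesis by (simp add: f_def)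
  qed
  have "energy G h f = h (tgt e) - h (src e)" for h
  proof -
    have "energy (delete_edge G e) h f = 0"
      unfolding energy_def by (rule sum.neutral) (auto simp: delete_edge_def f_edge)
    then show ?thesis using energy_delete[OF e, of h f] len_pos[OF e] by (simp add: f_src f_tgt)
  qed
  then have "volt G (src e) (tgt e) x = f x" if "x \<in> V" for x
    using volt_eqI[of f "tgt e" "src e" x] e that by (simp add: f_src)
  then show ?thesis using that[of f] f_tgt by (auto simp: f_def)
qed

section \<open>Edge terms as functions of the resistance\<close>

text \<open>Uniform formulas that absorb the limit conventions: for a bridge \<open>\<rho> e\<close>
  is the length and the voltage at \<open>p\<close> is 0 or the length, so the difference of
  resistances to \<open>p\<close> is plus or minus the length.\<close>

lemma edge_terms:
  assumes e: "e \<in> E"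
  shows "ratio G e = \<rho> e / len G e"
    and "yterm1 G e = (\<rho> e)\<^sup>2 / len G e"
    and "p \<in> V \<Longrightarrow> yterm2 G e p = (r (src e) p - r (tgt e) p)\<^sup>2 / len G e"
proof -
  have diff: "r (src e) p - r (tgt e) p = 2 * volt G (src e) (tgt e) p - \<rho> e" if "p \<in> V" for p
    using that e volt_conv_resist[of p "tgt e" "src e"] resist_commute by simp
  have rho: "\<rho> e = volt G (src e) (tgt e) (tgt e)" by (simp add: resist_def)
  have L: "len G e > 0" using e by (rule len_pos)
  have "ratio G e = \<rho> e / len G e \<and> yterm1 G e = (\<rho> e)\<^sup>2 / len G e \<and>
      (p \<in> V \<longrightarrow> yterm2 G e p = (r (src e) p - r (tgt e) p)\<^sup>2 / len G e)"
  proof (cases "is_bridge G e")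
    case True
    obtain f where f: "\<And>x. x \<in> V \<Longrightarrow> volt G (src e) (tgt e) x = f x"
      "\<And>x. f x = 0 \<or> f x = len G e" "f (tgt e) = len G e" by (rule bridge_volt[OF e True]) blast
    then have rho': "\<rho> e = len G e" using e rho by simp
    have "(r (src e) p - r (tgt e) p)\<^sup>2 = (len G e)\<^sup>2" if "p \<in> V"
      unfolding diff[OF that] rho' using f(1)[OF that] f(2)[of p] by auto
    then show ?thesis using True L
      by (simp add: ratio_def yterm1_def yterm2_def rho' power2_eq_square)
  next
    case False
    note D = volt_conv_delete[OF e False]
    define R where "R = Rdel G e"
    have Ra_tgt: "Ra G e (tgt e) = R" by (simp add: R_def Ra_def Rdel_def resist_def)
    have S: "len G e + R > 0" using L D(3)[of "tgt e"] e by (simp add: R_def)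
    have rho': "\<rho> e = len G e * R / (len G e + R)" using rho D(1)[of "tgt e"] e Ra_tgt by (simp add: R_def)
    have d: "r (src e) p - r (tgt e) p = len G e * (Ra G e p - Rb G e p) / (len G e + R)" if "p \<in> V"
      unfolding diff[OF that] D(1)[OF that] D(2)[OF that] rho' R_def[symmetric]
      by (simp add: algebra_simps diff_divide_distrib)
    have sq: "(len G e * t / (len G e + R))\<^sup>2 / len G e = len G e * t\<^sup>2 / (len G e + R)\<^sup>2" for t
      using L by (simp add: power2_eq_square)
    show ?thesis using False L
      by (simp add: ratio_def yterm1_def yterm2_def rho' d sq R_def[symmetric])
  qed
  then show "ratio G e = \<rho> e / len G e" "yterm1 G e = (\<rho> e)\<^sup>2 / len G e"
    "p \<in> V \<Longrightarrow> yterm2 G e p = (r (src e) p - r (tgt e) p)\<^sup>2 / len G e" by blast+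
qed

lemma yinv_conv:
  assumes "p \<in> V"
  shows "yinv G p = 1/4 * (\<Sum>e\<in>E. (\<rho> e)\<^sup>2 / len G e) + 3/4 * energy G (\<lambda>x. r x p) (\<lambda>x. r x p)"
  using assms by (simp add: yinv_def energy_def edge_terms power2_eq_square)

lemma yinv_indep: "p \<in> V \<Longrightarrow> q \<in> V \<Longrightarrow> yinv G p = yinv G q"
  by (simp add: yinv_conv energy_resist_indep[of p q])

subsection \<open>Contraction of an edge\<close>

definition glue :: "'b \<Rightarrow> 'a \<Rightarrow> 'a" where
  "glue e x = (if x = tgt e then src e else x)"

lemma contract_simps:
  "verts (contract G e) = glue e ` V" "edges (contract G e) = E - {e}"
  "ends (contract G e) d = (glue e (src d), glue e (tgt d))" "len (contract G e) = len G"
  by (simp_all add: contract_def Let_def glue_def[abs_def])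

lemma contract_metrized:
  assumes "e \<in> E"
  shows "metrized (contract G e)"
proof
  have step: "(glue e x, glue e y) \<in> (adj (contract G e))\<^sup>*" if "(x, y) \<in> adj G" for x y
  proof -
    from that obtain d where d: "d \<in> E" "ends G d = (x, y) \<or> ends G d = (y, x)" by (auto simp: adj_def)
    show ?thesis
    proof (cases "d = e")
      case True
      then have "glue e x = glue e y" using d by (metis fst_conv snd_conv glue_def)
      then show ?thesis by simp
    next
      case False
      then have "(glue e x, glue e y) \<in> adj (contract G e)"
        unfolding adj_def using d by (auto simp: contract_simps intro!: bexI[of _ d])
      then show ?thesis ..
    qed
  qed
  have "(glue e x, glue e y) \<in> (adj (contract G e))\<^sup>*" if "(x, y) \<in> (adj G)\<^sup>*" for x y
    using that by induction (auto intro: rtrancl_trans step)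
  then have "connected_mg (contract G e)"
    using connected by (auto simp: connected_mg_def contract_simps)
  then show "metrized_graph (contract G e)"
    using V_nonempty len_pos by (auto simp: metrized_graph_def contract_simps)
qed

lemma glue_image: "e \<in> E \<Longrightarrow> src e \<noteq> tgt e \<Longrightarrow> glue e ` V = V - {tgt e}"
  by (auto simp: glue_def image_iff)

text \<open>Functions pulled back along \<open>glue e\<close> agree at the ends of \<open>e\<close>,
  so the missing edge has a zero term.\<close>

lemma energy_contract:
  assumes "e \<in> E"
  shows "energy (contract G e) f h = energy G (\<lambda>x. f (glue e x)) (\<lambda>x. h (glue e x))"
  using assms by (simp add: energy_def contract_simps sum.remove[of E e])
    (simp add: glue_def)

text \<open>The voltage function \<open>volt G (src e) (tgt e)\<close> shifted by
  \<open>\<rho> e / 2\<close>, so that its values at the two ends of \<open>e\<close> are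
  opposite.\<close>

definition half_diff :: "'b \<Rightarrow> 'a \<Rightarrow> real" where
  "half_diff e x = (r x (src e) - r x (tgt e)) / 2"

text \<open>Adding a multiple of the unit flow through the contracted edge to a potential makes its
  values at the two end points agree, so that it descends to the contracted graph.\<close>

lemma resist_contract:
  assumes e: "e \<in> E" and ne: "src e \<noteq> tgt e" and xy: "x \<in> V" "y \<in> V"
  shows "resist (contract G e) (glue e x) (glue e y)
    = r x y - (half_diff e x - half_diff e y)\<^sup>2 / \<rho> e"
proof -
  interpret C: metrized "contract G e" by (rule contract_metrized[OF e])
  define a b where "a = src e" and "b = tgt e"
  have ab: "a \<in> V" "b \<in> V" using e by (simp_all add: a_def b_def)
  have rho: "r a b \<noteq> 0" using resist_pos[of a b] ab ne by (simp add: a_def b_def)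
  define u where "u = volt G a b"
  define c where "c = (volt G x y b - volt G x y a) / r a b"
  define \<phi> where "\<phi> w = volt G x y w - c * u w" for w
  have ua: "u a = 0" and ub: "u b = r a b" using ab by (simp_all add: u_def resist_def)
  have "\<phi> a = \<phi> b" using rho by (simp add: \<phi>_def ua ub c_def)
  then have glue: "\<phi> (glue e w) = \<phi> w" for w by (simp add: glue_def a_def b_def)
  have en: "energy (contract G e) h \<phi> = h (glue e y) - h (glue e x)" for h
  proof -
    have "energy (contract G e) h \<phi> = energy G (\<lambda>w. h (glue e w)) \<phi>"
      using e by (simp add: energy_contract glue)
    also have "\<dots> = (h (glue e y) - h (glue e x)) - c * (h (glue e b) - h (glue e a))"
      unfolding \<phi>_def u_def using xy ab by (simp add: energy_linear energy_volt)
    also have "h (glue e b) = h (glue e a)" by (simp add: glue_def a_def b_def)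
    finally show ?thesis by simp
  qed
  have "resist (contract G e) (glue e x) (glue e y) = \<phi> (glue e y) - \<phi> (glue e x)"
    unfolding resist_def using xy by (intro C.volt_eqI en) (auto simp: contract_simps)
  also have "\<dots> = r x y - c * (u y - u x)"
    unfolding glue using xy by (simp add: \<phi>_def resist_def algebra_simps)
  also have "u y - u x = half_diff e y - half_diff e x"
    using xy ab by (simp add: u_def volt_conv_resist half_diff_def a_def b_def field_simps)
  \<comment> \<open>By \<open>volt_conv_resist\<close> the numerator of \<open>c\<close> is the same
    difference of \<open>half_diff\<close> values, which yields the square.\<close>
  also have "c * (half_diff e y - half_diff e x) = (half_diff e x - half_diff e y)\<^sup>2 / r a b"
    using xy ab resist_commute by (simp add: c_def volt_conv_resist half_diff_def a_def b_def power2_eq_square field_simps)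
  finally show ?thesis by (simp add: a_def b_def)
qed

text \<open>Exchanging the roles of the edge and the pair turns the sum into a quarter of the energy
  of \<open>r(., x) - r(., y)\<close>: the power dissipated by a unit current equals the
  resistance.\<close>

lemma sum_half_diff_diff:
  assumes "x \<in> V" "y \<in> V"
  shows "(\<Sum>e\<in>E. (half_diff e x - half_diff e y)\<^sup>2 / len G e) = r x y"
proof -
  define D where "D z = r z x - r z y" for z
  have "(\<Sum>e\<in>E. (half_diff e x - half_diff e y)\<^sup>2 / len G e) = energy G D D / 4"
    unfolding energy_def sum_divide_distrib
  proof (rule sum.cong[OF refl])
    fix e assume e: "e \<in> E"
    have eq: "half_diff e x - half_diff e y = (D (src e) - D (tgt e)) / 2"
      using e assms by (simp add: half_diff_def D_def resist_commute field_simps)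
    show "(half_diff e x - half_diff e y)\<^sup>2 / len G e
        = (D (src e) - D (tgt e)) * (D (src e) - D (tgt e)) / len G e / 4"
      unfolding eq by (simp add: power2_eq_square)
  qed
  also have "energy G D D = -2 * (D x - D y)"
    unfolding D_def using energy_resist_diff[OF assms, of "\<lambda>z. r z x - r z y"] .
  finally show ?thesis using assms by (simp add: D_def resist_commute)
qed

lemma sum_half_diff:
  assumes "x \<in> V"
  shows "(\<Sum>e\<in>E. (half_diff e x)\<^sup>2 / len G e) = energy G (\<lambda>w. r w x) (\<lambda>w. r w x) / 4"
  unfolding energy_def sum_divide_distrib
  by (rule sum.cong) (use assms in \<open>simp_all add: half_diff_def resist_commute power2_eq_square\<close>)

lemma half_diff_ends:
  assumes "e \<in> E"
  shows "half_diff e (src e) = - \<rho> e / 2" "half_diff e (tgt e) = \<rho> e / 2"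
  using assms by (simp_all add: half_diff_def resist_commute)

lemma resist_contract_src:
  assumes e: "e \<in> E" and ne: "src e \<noteq> tgt e" and x: "x \<in> V"
  shows "resist (contract G e) (glue e x) (src e)
    = (r x (src e) + r x (tgt e)) / 2 - (half_diff e x)\<^sup>2 / \<rho> e - \<rho> e / 4"
proof -
  have rho: "\<rho> e \<noteq> 0" using resist_pos[of "src e" "tgt e"] e ne by simp
  have "glue e (src e) = src e" by (simp add: glue_def)
  then have "resist (contract G e) (glue e x) (src e)
      = r x (src e) - (half_diff e x + \<rho> e / 2)\<^sup>2 / \<rho> e"
    using resist_contract[OF e ne x, of "src e"] e by (simp add: half_diff_ends)
  also have "(half_diff e x + \<rho> e / 2)\<^sup>2 / \<rho> e = (half_diff e x)\<^sup>2 / \<rho> e + half_diff e x + \<rho> e / 4"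
    using rho by (simp add: power2_eq_square field_simps)
  finally show ?thesis by (simp add: half_diff_def field_simps)
qed

subsection \<open>Averaging over contractions\<close>

text \<open>Summing over \<open>V\<close> counts the merged vertex twice; the last sum removes the
  row and column of \<open>tgt e\<close>. The factor \<open>\<rho> e\<close> clears the denominators
  of \<open>resist_contract\<close>.\<close>

lemma Kf_contract:
  assumes e: "e \<in> E" and ne: "src e \<noteq> tgt e"
  shows "\<rho> e * Kf (contract G e) = \<rho> e * Kf G
    - 1/2 * (\<Sum>x\<in>V. \<Sum>y\<in>V. (half_diff e x - half_diff e y)\<^sup>2)
    - (\<Sum>x\<in>V. \<rho> e * (r x (src e) + r x (tgt e)) / 2 - (half_diff e x)\<^sup>2 - (\<rho> e)\<^sup>2 / 4)"
proof -
  interpret C: metrized "contract G e" by (rule contract_metrized[OF e])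
  define b where "b = tgt e"
  define q where "q x y = resist (contract G e) (glue e x) (glue e y)" for x y
  have b: "b \<in> V" using e by (simp add: b_def)
  have rho: "\<rho> e \<noteq> 0" using resist_pos[of "src e" "tgt e"] e ne by simp
  have gV: "glue e x \<in> C.V" if "x \<in> V" for x using that by (simp add: contract_simps)
  have q_commute: "q x y = q y x" if "x \<in> V" "y \<in> V" for x y
    using that gV C.resist_commute by (simp add: q_def)
  have q_b: "q x b = (r x (src e) + r x (tgt e)) / 2 - (half_diff e x)\<^sup>2 / \<rho> e - \<rho> e / 4"
    if "x \<in> V" for x
    using resist_contract_src[OF e ne that] by (simp add: q_def b_def glue_def)
  have Kf': "2 * Kf (contract G e) = (\<Sum>x\<in>V - {b}. \<Sum>y\<in>V - {b}. q x y)"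
    unfolding Kf_def contract_simps(1) glue_image[OF e ne] b_def
    by (simp, intro sum.cong refl) (simp add: q_def glue_def)
  have "(\<Sum>x\<in>V. \<Sum>y\<in>V. q x y) = (\<Sum>x\<in>V. q x b) + (\<Sum>x\<in>V. \<Sum>y\<in>V - {b}. q x y)"
    using b by (simp add: sum.remove[of V b "q _"] sum.distrib)
  also have "(\<Sum>x\<in>V. \<Sum>y\<in>V - {b}. q x y)
      = (\<Sum>y\<in>V - {b}. q b y) + (\<Sum>x\<in>V - {b}. \<Sum>y\<in>V - {b}. q x y)"
    using b by (intro sum.remove) auto
  also have "(\<Sum>y\<in>V - {b}. q b y) = (\<Sum>y\<in>V. q y b)"
  proof -
    have "(\<Sum>y\<in>V. q y b) = (\<Sum>y\<in>V. q b y)" using b q_commute by (intro sum.cong) auto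
    moreover have "q b b = 0" using gV[OF b] by (simp add: q_def)
    ultimately show ?thesis using b by (simp add: sum.remove[of V b])
  qed
  finally have Kf: "Kf (contract G e) = (\<Sum>x\<in>V. \<Sum>y\<in>V. q x y) / 2 - (\<Sum>x\<in>V. q x b)"
    using Kf' by linarith
  have "\<rho> e * Kf (contract G e)
      = 1/2 * (\<Sum>x\<in>V. \<Sum>y\<in>V. \<rho> e * q x y) - (\<Sum>x\<in>V. \<rho> e * q x b)"
    unfolding Kf sum_distrib_left[symmetric] by (simp add: right_diff_distrib)
  also have "(\<Sum>x\<in>V. \<Sum>y\<in>V. \<rho> e * q x y)
      = (\<Sum>x\<in>V. \<Sum>y\<in>V. \<rho> e * r x y - (half_diff e x - half_diff e y)\<^sup>2)"
    using rho by (intro sum.cong refl) (simp add: q_def resist_contract[OF e ne] right_diff_distrib)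
  also have "\<dots> = 2 * (\<rho> e * Kf G) - (\<Sum>x\<in>V. \<Sum>y\<in>V. (half_diff e x - half_diff e y)\<^sup>2)"
    by (simp add: Kf_def sum_subtractf sum_distrib_left)
  also have "(\<Sum>x\<in>V. \<rho> e * q x b)
      = (\<Sum>x\<in>V. \<rho> e * (r x (src e) + r x (tgt e)) / 2 - (half_diff e x)\<^sup>2 - (\<rho> e)\<^sup>2 / 4)"
    using rho by (intro sum.cong refl) (simp add: q_b right_diff_distrib power2_eq_square)
  finally show ?thesis by (simp add: right_diff_distrib)
qed

text \<open>Self-loops may be put back into the sum because they have resistance 0.\<close>

lemma sum_nonloop_ratio:
  assumes "\<And>e. e \<in> nonloop_edges G \<Longrightarrow> \<rho> e * f e = h e" "\<And>e. e \<in> E \<Longrightarrow> src e = tgt e \<Longrightarrow> h e = 0"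
  shows "(\<Sum>e\<in>nonloop_edges G. ratio G e * f e) = (\<Sum>e\<in>E. h e / len G e)"
proof -
  have "(\<Sum>e\<in>nonloop_edges G. ratio G e * f e) = (\<Sum>e\<in>nonloop_edges G. h e / len G e)"
    by (rule sum.cong) (auto simp: nonloop_edges_def edge_terms(1) assms(1)[symmetric])
  also have "\<dots> = (\<Sum>e\<in>E. h e / len G e)"
    by (rule sum.mono_neutral_left) (use assms(2) in \<open>auto simp: nonloop_edges_def\<close>)
  finally show ?thesis .
qed

text \<open>With \<open>v\<close> the number of vertices, the five sums give
  \<open>(v - 1) Kf - Kf - (2 Kf - v En / 2) + v En / 4 + v S / 4\<close>; the \<open>En\<close> and
  \<open>S\<close> terms combine to \<open>v\<close> times \<open>yinv\<close>.\<close>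

theorem sum_ratio_Kf_contract:
  assumes p: "p \<in> V"
  shows "(\<Sum>e\<in>nonloop_edges G. ratio G e * Kf (contract G e))
    = (real (card V) - 4) * Kf G + real (card V) * yinv G p"
proof -
  define En where "En = energy G (\<lambda>x. r x p) (\<lambda>x. r x p)"
  define S where "S = (\<Sum>e\<in>E. (\<rho> e)\<^sup>2 / len G e)"
  have En: "energy G (\<lambda>w. r w x) (\<lambda>w. r w x) = En" if "x \<in> V" for x
    unfolding En_def using that p by (rule energy_resist_indep)
  have Kf2: "(\<Sum>x\<in>V. \<Sum>y\<in>V. r x y) = 2 * Kf G" by (simp add: Kf_def)
  have "(\<Sum>e\<in>nonloop_edges G. ratio G e * Kf (contract G e)) = (\<Sum>e\<in>E. (\<rho> e * Kf G
    - 1/2 * (\<Sum>x\<in>V. \<Sum>y\<in>V. (half_diff e x - half_diff e y)\<^sup>2)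
    - (\<Sum>x\<in>V. \<rho> e * (r x (src e) + r x (tgt e)) / 2 - (half_diff e x)\<^sup>2 - (\<rho> e)\<^sup>2 / 4)) / len G e)"
    (is "_ = (\<Sum>e\<in>E. ?K e)")
    by (rule sum_nonloop_ratio) (auto simp: Kf_contract nonloop_edges_def half_diff_def)
  also have "\<dots> = Kf G * (\<Sum>e\<in>E. \<rho> e / len G e)
    - 1/2 * (\<Sum>e\<in>E. \<Sum>x\<in>V. \<Sum>y\<in>V. (half_diff e x - half_diff e y)\<^sup>2 / len G e)
    - 1/2 * (\<Sum>e\<in>E. \<Sum>x\<in>V. (r (src e) x + r (tgt e) x) * \<rho> e / len G e)
    + (\<Sum>e\<in>E. \<Sum>x\<in>V. (half_diff e x)\<^sup>2 / len G e) + real (card V) / 4 * S"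
  proof -
    have "?K e = Kf G * (\<rho> e / len G e)
    - 1/2 * (\<Sum>x\<in>V. \<Sum>y\<in>V. (half_diff e x - half_diff e y)\<^sup>2 / len G e)
    - 1/2 * (\<Sum>x\<in>V. (r (src e) x + r (tgt e) x) * \<rho> e / len G e)
    + (\<Sum>x\<in>V. (half_diff e x)\<^sup>2 / len G e) + real (card V) / 4 * ((\<rho> e)\<^sup>2 / len G e)"
      if e: "e \<in> E" for e
    proof -
    have "(\<Sum>x\<in>V. \<rho> e * (r x (src e) + r x (tgt e)) / 2)
        = (\<Sum>x\<in>V. (r (src e) x + r (tgt e) x) * \<rho> e) / 2"
      unfolding sum_divide_distrib using e by (intro sum.cong) (simp_all add: resist_commute)
    then have eq: "(\<Sum>x\<in>V. \<rho> e * (r x (src e) + r x (tgt e)) / 2 - (half_diff e x)\<^sup>2 - (\<rho> e)\<^sup>2 / 4)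
      = (\<Sum>x\<in>V. (r (src e) x + r (tgt e) x) * \<rho> e) / 2
        - (\<Sum>x\<in>V. (half_diff e x)\<^sup>2) - real (card V) * (\<rho> e)\<^sup>2 / 4"
      by (simp add: sum_subtractf)
    show ?thesis
      unfolding eq sum_divide_distrib[symmetric]
      using len_pos[OF e] by (simp add: field_simps)
    qed
    then have "(\<Sum>e\<in>E. ?K e) = (\<Sum>e\<in>E. Kf G * (\<rho> e / len G e)
    - 1/2 * (\<Sum>x\<in>V. \<Sum>y\<in>V. (half_diff e x - half_diff e y)\<^sup>2 / len G e)
    - 1/2 * (\<Sum>x\<in>V. (r (src e) x + r (tgt e) x) * \<rho> e / len G e)
    + (\<Sum>x\<in>V. (half_diff e x)\<^sup>2 / len G e) + real (card V) / 4 * ((\<rho> e)\<^sup>2 / len G e))"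
      by (rule sum.cong[OF refl])
    then show ?thesis
      unfolding S_def by (simp only: sum_subtractf sum.distrib sum_distrib_left[symmetric])
  qed
  also have "(\<Sum>e\<in>E. \<Sum>x\<in>V. \<Sum>y\<in>V. (half_diff e x - half_diff e y)\<^sup>2 / len G e) = 2 * Kf G"
  proof -
    have "(\<Sum>e\<in>E. \<Sum>x\<in>V. \<Sum>y\<in>V. (half_diff e x - half_diff e y)\<^sup>2 / len G e)
        = (\<Sum>x\<in>V. \<Sum>y\<in>V. \<Sum>e\<in>E. (half_diff e x - half_diff e y)\<^sup>2 / len G e)"
      by (subst sum.swap, subst sum.swap[of _ V E]) (rule refl)
    then show ?thesis by (simp add: sum_half_diff_diff Kf2)
  qed
  also have "(\<Sum>e\<in>E. \<Sum>x\<in>V. (r (src e) x + r (tgt e) x) * \<rho> e / len G e)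
      = 4 * Kf G - real (card V) * En"
  proof -
    have "(\<Sum>e\<in>E. \<Sum>x\<in>V. (r (src e) x + r (tgt e) x) * \<rho> e / len G e)
        = (\<Sum>x\<in>V. 2 * (\<Sum>w\<in>V. r w x) - En)"
      by (subst sum.swap) (simp add: sum_edges_resist_vertex En)
    also have "(\<Sum>x\<in>V. \<Sum>w\<in>V. r w x) = (\<Sum>x\<in>V. \<Sum>y\<in>V. r x y)" by (rule sum.swap)
    then have "(\<Sum>x\<in>V. 2 * (\<Sum>w\<in>V. r w x) - En) = 4 * Kf G - real (card V) * En"
      by (simp add: sum_subtractf sum_distrib_left[symmetric] Kf2)
    finally show ?thesis .
  qed
  also have "(\<Sum>e\<in>E. \<Sum>x\<in>V. (half_diff e x)\<^sup>2 / len G e) = real (card V) * En / 4"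
    by (subst sum.swap) (simp add: sum_half_diff En)
  finally show ?thesis
    unfolding yinv_conv[OF p] foster En_def[symmetric] S_def[symmetric] by (simp add: field_simps)
qed

text \<open>By independence of the base point, \<open>y\<close> of the contracted graph is computed with the point
  to which the edge is contracted as base point.\<close>

lemma yinv_contract:
  assumes e: "e \<in> E" and ne: "src e \<noteq> tgt e" and p: "p \<in> V"
  shows "\<rho> e * yinv (contract G e) (glue e p) = \<rho> e * yinv G p
    - 1/2 * (\<Sum>d\<in>E. \<rho> d * (half_diff e (src d) - half_diff e (tgt d))\<^sup>2 / len G d)
    - 3/2 * (\<Sum>x\<in>V. (half_diff e x)\<^sup>2 * \<kappa> x) + (\<rho> e)\<^sup>2 / 4"
proof -
  interpret C: metrized "contract G e" by (rule contract_metrized[OF e])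
  define a b where "a = src e" and "b = tgt e"
  define R where "R = \<rho> e"
  define w where "w = half_diff e"
  define s where "s x = 1/2 * (r x a + r x b)" for x
  define m where "m d = w (src d) - w (tgt d)" for d
  define En where "En = energy G (\<lambda>x. r x p) (\<lambda>x. r x p)"
  define S where "S = (\<Sum>d\<in>E. (\<rho> d)\<^sup>2 / len G d)"
  have ab: "a \<in> V" "b \<in> V" using e by (simp_all add: a_def b_def)
  have R: "R = r a b" "R \<noteq> 0" using resist_pos[of a b] ab ne by (simp_all add: R_def a_def b_def)
  have wab: "w a = - R / 2" "w b = R / 2" using e by (simp_all add: w_def a_def b_def R_def half_diff_ends)
  have En: "energy G (\<lambda>x. r x q) (\<lambda>x. r x q) = En" if "q \<in> V" for q
    unfolding En_def using that p by (rule energy_resist_indep)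

  have "yinv (contract G e) (glue e p) = yinv (contract G e) (glue e a)"
    using p ab by (intro C.yinv_indep) (simp_all add: contract_simps)
  also have "\<dots> = 1/4 * (\<Sum>d\<in>C.E. (C.\<rho> d)\<^sup>2 / len G d)
     + 3/4 * energy (contract G e) (\<lambda>x. C.r x (glue e a)) (\<lambda>x. C.r x (glue e a))"
    using ab by (subst C.yinv_conv) (simp_all add: contract_simps)
  also have "(\<Sum>d\<in>C.E. (C.\<rho> d)\<^sup>2 / len G d) = (\<Sum>d\<in>E. (\<rho> d - (m d)\<^sup>2 / R)\<^sup>2 / len G d)"
  proof -
    \<comment> \<open>The contracted edge may be put back: its ends are glued, so its resistance
      there is 0.\<close>
    have "(\<Sum>d\<in>C.E. (C.\<rho> d)\<^sup>2 / len G d) = (\<Sum>d\<in>E. (C.\<rho> d)\<^sup>2 / len G d)"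
    proof (rule sum.mono_neutral_left)
      have "glue e (src e) = glue e (tgt e)" by (simp add: glue_def)
      then have "C.\<rho> e = 0" using e by (simp add: contract_simps)
      then show "\<forall>d\<in>E - C.E. (C.\<rho> d)\<^sup>2 / len G d = 0" by (auto simp: contract_simps(2))
    qed (auto simp: contract_simps)
    also have "\<dots> = (\<Sum>d\<in>E. (\<rho> d - (m d)\<^sup>2 / R)\<^sup>2 / len G d)"
      by (rule sum.cong) (simp_all add: contract_simps resist_contract[OF e ne] m_def w_def R_def)
    finally show ?thesis .
  qed
  also have "\<dots> = S - 2 / R * (\<Sum>d\<in>E. \<rho> d * (m d)\<^sup>2 / len G d) + 1 / R\<^sup>2 * (\<Sum>d\<in>E. (m d)^4 / len G d)"
    unfolding S_def sum_distrib_left sum_subtractf[symmetric] sum.distrib[symmetric]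
    using R(2) by (intro sum.cong) (simp_all add: field_simps power2_eq_square power4_eq_xxxx)
  also have "energy (contract G e) (\<lambda>x. C.r x (glue e a)) (\<lambda>x. C.r x (glue e a))
      = energy G (\<lambda>x. s x - 1 / R * (w x)\<^sup>2 - R / 4) (\<lambda>x. s x - 1 / R * (w x)\<^sup>2 - R / 4)"
  proof -
    have "glue e a = a" by (simp add: glue_def a_def)
    then show ?thesis unfolding energy_contract[OF e]
      by (intro energy_cong)
        (simp_all add: a_def b_def R_def w_def s_def resist_contract_src[OF e ne])
  qed
  also have "\<dots> = energy G s s - 2 / R * energy G s (\<lambda>x. (w x)\<^sup>2)
      + 1 / R\<^sup>2 * energy G (\<lambda>x. (w x)\<^sup>2) (\<lambda>x. (w x)\<^sup>2)"
    by (simp only: energy_linear energy_commute[of G "\<lambda>x. (w x)\<^sup>2" s])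
      (simp add: power2_eq_square algebra_simps)
  finally have yinv: "yinv (contract G e) (glue e p) = 1/4 * (S - 2 / R * (\<Sum>d\<in>E. \<rho> d * (m d)\<^sup>2 / len G d)
      + 1 / R\<^sup>2 * (\<Sum>d\<in>E. (m d)^4 / len G d))
    + 3/4 * (energy G s s - 2 / R * energy G s (\<lambda>x. (w x)\<^sup>2)
      + 1 / R\<^sup>2 * energy G (\<lambda>x. (w x)\<^sup>2) (\<lambda>x. (w x)\<^sup>2))" .
  \<comment> \<open>Only the quartic terms keep a denominator; their combination turns out to be
    \<open>R^3 / 4\<close>, so it cancels.\<close>
  have y: "R * yinv (contract G e) (glue e p) = 1/4 * R * S
      - 1/2 * (\<Sum>d\<in>E. \<rho> d * (m d)\<^sup>2 / len G d)
      + 3/4 * (R * energy G s s) - 3/2 * energy G s (\<lambda>x. (w x)\<^sup>2)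
      + 1 / R * (1/4 * (\<Sum>d\<in>E. (m d)^4 / len G d)
                  + 3/4 * energy G (\<lambda>x. (w x)\<^sup>2) (\<lambda>x. (w x)\<^sup>2))"
  proof -
    have "R * (1/4 * (S - 2/R * A + 1/R\<^sup>2 * B) + 3/4 * (C - 2/R * D + 1/R\<^sup>2 * F))
      = 1/4 * R * S - 1/2 * A + 3/4 * (R * C) - 3/2 * D + 1/R * (1/4 * B + 3/4 * F)" for A B C D F
      using R(2) by (simp add: field_simps power2_eq_square)
    then show ?thesis unfolding yinv .
  qed

  \<comment> \<open>The outflow of \<open>s\<close> is \<open>\<kappa>\<close> minus a unit mass at
    each of \<open>a\<close> and \<open>b\<close>.\<close>
  have s_right: "energy G f s = (\<Sum>x\<in>V. f x * \<kappa> x) - f a - f b" for f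
    unfolding s_def using ab by (simp only: energy_scale_right energy_add_right energy_resist) simp
  have ha: "energy G s (\<lambda>x. r x a) = En - R" and hb: "energy G s (\<lambda>x. r x b) = En - R"
    using ab resist_commute[of a b] energy_resist_self[of a] energy_resist_self[of b] En[of a] En[of b]
    by (simp_all add: energy_commute[of G s] s_right R(1))
  have ss: "energy G s s = En - R"
  proof -
    have "energy G s s = 1/2 * (energy G s (\<lambda>x. r x a) + energy G s (\<lambda>x. r x b))"
      by (subst (2) s_def[abs_def]) (simp only: energy_scale_right energy_add_right)
    then show ?thesis by (simp add: ha hb)
  qed
  have sw: "energy G s (\<lambda>x. (w x)\<^sup>2) = (\<Sum>x\<in>V. (w x)\<^sup>2 * \<kappa> x) - R\<^sup>2 / 2"
    by (simp add: energy_commute[of G s] s_right wab power2_eq_square)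
  \<comment> \<open>\<open>(x - y)\<^sup>4 / 4 + 3 (x\<^sup>2 - y\<^sup>2)\<^sup>2 / 4 = (x\<^sup>3 - y\<^sup>3) (x - y)\<close>
    turns the two quartic sums into the energy of \<open>w\<^sup>3\<close> against \<open>w\<close>.\<close>
  have "1/4 * (\<Sum>d\<in>E. (m d)^4 / len G d) + 3/4 * energy G (\<lambda>x. (w x)\<^sup>2) (\<lambda>x. (w x)\<^sup>2)
      = energy G (\<lambda>x. (w x)^3) w"
  proof -
    have id: "1/4 * ((x - y)^4 / l) + 3/4 * ((x\<^sup>2 - y\<^sup>2) * (x\<^sup>2 - y\<^sup>2) / l)
        = (x^3 - y^3) * (x - y) / l" for x y l :: real
    proof -
      have "1/4 * (x - y)^4 + 3/4 * ((x\<^sup>2 - y\<^sup>2) * (x\<^sup>2 - y\<^sup>2)) = (x^3 - y^3) * (x - y)"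
        by (simp add: power2_eq_square power3_eq_cube power4_eq_xxxx algebra_simps)
      then show ?thesis by (metis add_divide_distrib times_divide_eq_right)
    qed
    show ?thesis unfolding energy_def sum_distrib_left sum.distrib[symmetric] m_def
      by (rule sum.cong[OF refl]) (rule id)
  qed
  also have "\<dots> = R^3 / 4"
  proof -
    have "w = (\<lambda>x. 1/2 * (r x a - r x b))" by (simp add: fun_eq_iff w_def half_diff_def a_def b_def)
    then have "energy G (\<lambda>x. (w x)^3) w = 1/2 * energy G (\<lambda>x. (w x)^3) (\<lambda>x. r x a - r x b)"
      by (metis energy_scale_right)
    also have "\<dots> = - ((w a)^3 - (w b)^3)" using ab by (simp add: energy_resist_diff)
    finally show ?thesis by (simp add: wab power3_eq_cube)
  qed
  finally have quart: "1/4 * (\<Sum>d\<in>E. (m d)^4 / len G d)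
      + 3/4 * energy G (\<lambda>x. (w x)\<^sup>2) (\<lambda>x. (w x)\<^sup>2) = R^3 / 4" .
  have "R * yinv (contract G e) (glue e p) = R * (1/4 * S + 3/4 * En)
      - 1/2 * (\<Sum>d\<in>E. \<rho> d * (m d)\<^sup>2 / len G d) - 3/2 * (\<Sum>x\<in>V. (w x)\<^sup>2 * \<kappa> x) + R\<^sup>2 / 4"
    unfolding y quart ss sw using R(2) by (simp add: power3_eq_cube power2_eq_square field_simps)
  then show ?thesis unfolding yinv_conv[OF p] by (simp only: R_def S_def En_def m_def w_def)
qed

text \<open>Foster's theorem gives \<open>v - 1\<close> copies of \<open>yinv\<close>; the other
  terms add up to \<open>- S / 2 - 3/4 En + S / 4\<close>, which is exactly minus one copy.\<close>

theorem sum_ratio_yinv_contract: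
  assumes p: "p \<in> V"
  shows "(\<Sum>e\<in>nonloop_edges G. ratio G e * yinv (contract G e) (glue e p))
    = (real (card V) - 2) * yinv G p"
proof -
  define En where "En = energy G (\<lambda>x. r x p) (\<lambda>x. r x p)"
  define S where "S = (\<Sum>e\<in>E. (\<rho> e)\<^sup>2 / len G e)"
  have En: "energy G (\<lambda>w. r w x) (\<lambda>w. r w x) = En" if "x \<in> V" for x
    unfolding En_def using that p by (rule energy_resist_indep)
  have "(\<Sum>e\<in>nonloop_edges G. ratio G e * yinv (contract G e) (glue e p))
    = (\<Sum>e\<in>E. (\<rho> e * yinv G p
    - 1/2 * (\<Sum>d\<in>E. \<rho> d * (half_diff e (src d) - half_diff e (tgt d))\<^sup>2 / len G d)
    - 3/2 * (\<Sum>x\<in>V. (half_diff e x)\<^sup>2 * \<kappa> x) + (\<rho> e)\<^sup>2 / 4) / len G e)"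
    by (rule sum_nonloop_ratio) (auto simp: yinv_contract p nonloop_edges_def half_diff_def)
  also have "\<dots> = yinv G p * (\<Sum>e\<in>E. \<rho> e / len G e)
    - 1/2 * (\<Sum>e\<in>E. \<Sum>d\<in>E. \<rho> d / len G d * ((half_diff e (src d) - half_diff e (tgt d))\<^sup>2 / len G e))
    - 3/2 * (\<Sum>e\<in>E. \<Sum>x\<in>V. \<kappa> x * ((half_diff e x)\<^sup>2 / len G e)) + 1/4 * S"
    unfolding S_def sum_distrib_left sum_subtractf[symmetric] sum.distrib[symmetric]
    by (rule sum.cong) (simp_all add: add_divide_distrib diff_divide_distrib sum_divide_distrib mult_ac)
  \<comment> \<open>Summing over the contracted edge \<open>e\<close> first,
    \<open>sum_half_diff_diff\<close> at the ends of \<open>d\<close> gives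
    \<open>\<rho> d\<close>.\<close>
  also have "(\<Sum>e\<in>E. \<Sum>d\<in>E. \<rho> d / len G d * ((half_diff e (src d) - half_diff e (tgt d))\<^sup>2 / len G e)) = S"
  proof -
    have "(\<Sum>e\<in>E. \<Sum>d\<in>E. \<rho> d / len G d * ((half_diff e (src d) - half_diff e (tgt d))\<^sup>2 / len G e))
        = (\<Sum>d\<in>E. \<rho> d / len G d * (\<Sum>e\<in>E. (half_diff e (src d) - half_diff e (tgt d))\<^sup>2 / len G e))"
      unfolding sum_distrib_left by (rule sum.swap)
    also have "\<dots> = S"
      unfolding S_def by (rule sum.cong) (simp_all add: sum_half_diff_diff flip: power2_eq_square)
    finally show ?thesis .
  qed
  also have "(\<Sum>e\<in>E. \<Sum>x\<in>V. \<kappa> x * ((half_diff e x)\<^sup>2 / len G e)) = (\<Sum>x\<in>V. \<kappa> x) * (En / 4)"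
    unfolding sum_distrib_right
    by (subst sum.swap) (simp add: sum_distrib_left[symmetric] sum_half_diff En
        del: times_divide_eq_left times_divide_eq_right)
  finally show ?thesis
    unfolding yinv_conv[OF p] foster sum_\<kappa> En_def[symmetric] S_def[symmetric]
    by (simp add: field_simps)
qed

lemma card_contract:
  "e \<in> nonloop_edges G \<Longrightarrow> card (verts (contract G e)) = card V - 1"
  by (simp add: nonloop_edges_def contract_simps glue_image)

end

section \<open>Induction on the number of contractions\<close>

text \<open>Solved for \<open>csum\<close>, the formula suits the recursion: the induction
  hypothesis applies to each contracted graph, and the two averaging theorems return to
  \<open>G\<close>.\<close>

theorem csum_conv_Kf:
  assumes "metrized_graph G" "card (verts G) \<ge> k + 4" "p \<in> verts G"
  defines "v \<equiv> real (card (verts G))"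
  shows "csum k G = fact (card (verts G) - 4) / fact (card (verts G) - 4 - k)
    * (Kf G + (v\<^sup>2 - (real k + 2) * v + real k - 1) * real k / ((v - real k - 2) * (v - real k - 3))
        * yinv G p)"
  using assms(1-3) unfolding v_def
proof (induction k arbitrary: G p)
  case 0
  then show ?case by simp
next
  case (Suc k)
  interpret metrized G by standard (rule Suc.prems)
  \<comment> \<open>Writing \<open>card V = n + k + 5\<close> removes the truncated
    subtractions.\<close>
  define n where "n = card V - 5 - k"
  have card: "card V = n + k + 5" using Suc.prems(2) by (simp add: n_def)
  \<comment> \<open>\<open>c\<close> is the coefficient for \<open>k\<close> contractions and one
    vertex fewer, \<open>d\<close> the one for \<open>Suc k\<close> contractions of
    \<open>G\<close>; their denominators coincide.\<close>
  define c where "c = ((real (n + k + 4))\<^sup>2 - (real k + 2) * real (n + k + 4) + real k - 1) * real k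
      / ((real n + 2) * (real n + 1))"
  define d where "d = ((real (n + k + 5))\<^sup>2 - (real (Suc k) + 2) * real (n + k + 5) + real (Suc k) - 1)
      * real (Suc k) / ((real n + 2) * (real n + 1))"
  define F :: real where "F = fact (n + k) / fact n"
  have step: "csum k (contract G e) = F * (Kf (contract G e) + c * yinv (contract G e) (glue e p))"
    if e: "e \<in> nonloop_edges G" for e
  proof -
    have eE: "e \<in> E" using e by (simp add: nonloop_edges_def)
    have cd: "card (verts (contract G e)) = n + k + 4" using card_contract[OF e] card by simp
    have "metrized_graph (contract G e)" using contract_metrized[OF eE] by (simp add: metrized_def)
    from Suc.IH[OF this, of "glue e p"] show ?thesis
      using Suc.prems(3) by (simp add: cd[unfolded contract_simps] contract_simps(1) F_def c_def algebra_simps)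
  qed
  have "csum (Suc k) G = (\<Sum>e\<in>nonloop_edges G. F * (ratio G e * Kf (contract G e)
      + c * (ratio G e * yinv (contract G e) (glue e p))))"
    unfolding csum.simps by (rule sum.cong) (simp_all add: step algebra_simps)
  also have "\<dots> = F * ((real (card V) - 4) * Kf G + real (card V) * yinv G p
      + c * ((real (card V) - 2) * yinv G p))"
    unfolding sum_distrib_left[symmetric] sum.distrib
      sum_ratio_Kf_contract[OF Suc.prems(3)] sum_ratio_yinv_contract[OF Suc.prems(3)] ..
  also have "\<dots> = F * ((n + k + 1) * Kf G + (real (n + k + 5) + c * (real (n + k + 5) - 2)) * yinv G p)"
    by (simp add: card algebra_simps)
  \<comment> \<open>The recursion of the coefficients,
    \<open>v + c (v - 2) = (v - 4) d\<close>.\<close>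
  also have "real (n + k + 5) + c * (real (n + k + 5) - 2) = (n + k + 1) * d"
    unfolding c_def d_def by (simp add: divide_simps) (simp add: power2_eq_square algebra_simps)
  also have "F * ((n + k + 1) * Kf G + (n + k + 1) * d * yinv G p)
      = F * (n + k + 1) * (Kf G + d * yinv G p)"
    by (simp only: distrib_left mult.assoc)
  also have "F * (n + k + 1) = fact (card V - 4) / fact (card V - 4 - Suc k)"
    by (simp add: F_def card)
  finally show ?case by (simp add: card d_def algebra_simps)
qed

theorem theorem3p12:
  fixes G :: "('a, 'b) mgraph" and k :: nat and p :: 'a
  assumes "metrized_graph G"
    and "card (verts G) \<ge> 5"
    and "1 \<le> k" and "k \<le> card (verts G) - 4"
    and "p \<in> verts G"
  shows "(Kf G = fact (card (verts G) - 4 - k) / fact (card (verts G) - 4) * csum k G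
            - ((real (card (verts G)))\<^sup>2 - (real k + 2) * real (card (verts G)) + real k - 1) * real k
              / ((real (card (verts G)) - real k - 2) * (real (card (verts G)) - real k - 3))
              * yinv G p)
       \<and> (Kf G = 1 / fact (card (verts G) - 4) * csum (card (verts G) - 4) G
            - (3 * real (card (verts G)) - 5) * (real (card (verts G)) - 4) / 2 * yinv G p)"
proof
  show "Kf G = fact (card (verts G) - 4 - k) / fact (card (verts G) - 4) * csum k G
            - ((real (card (verts G)))\<^sup>2 - (real k + 2) * real (card (verts G)) + real k - 1) * real k
              / ((real (card (verts G)) - real k - 2) * (real (card (verts G)) - real k - 3))
              * yinv G p"
    using csum_conv_Kf[of G k p] assms by simp
  \<comment> \<open>For \<open>k = v - 4\<close> the denominator is \<open>2 * 1\<close>, and the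
    quadratic factor becomes \<open>3 v - 5\<close>.\<close>
  define m where "m = card (verts G) - 4"
  have card: "card (verts G) = m + 4" using assms(2) by (simp add: m_def)
  show "Kf G = 1 / fact (card (verts G) - 4) * csum (card (verts G) - 4) G
            - (3 * real (card (verts G)) - 5) * (real (card (verts G)) - 4) / 2 * yinv G p"
    using csum_conv_Kf[of G m p] assms(1,5) by (simp add: card power2_eq_square algebra_simps)
qed

end
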